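(* For all integers $n\geq 0$ we have $$\mathrm{Res}(p_n, q_{n+1}) = \mathrm{Res}(p_n, p_{n+1}) = (n+2)^{2n}\cdot 2^{4n(n+1)}$$ and $$\mathrm{Res}(p_n, q_n) = (n+1)^{2n-2}\cdot 2^{2(n-1)(2n+1)}\cdot\begin{cases}(n+2)^2 & (n \text{ even}),\\ (n+1)^2 & (n \text{ odd}).\end{cases}$$
   Context: The polynomials $p_n(z)\in\mathbb{Z}[z]$ ($n\ge 0$) are defined by the generating function (formal power series in $t$) $$\frac{1}{\left(1-(z+1)^2t\right)^2\left(1-(z-1)^2t\right)}=\sum_{n=0}^\infty p_n(z)t^n .$$ The polynomials $q_n(z)$ ($n\ge 0$) are defined by $$q_n(z) = (z+1)^{2n}\sum_{k=0}^n\left(\frac{z^2-1}{(z+1)^2}\right)^k T_k\!\left(\frac{z^2+1}{z^2-1}\right),$$ where $T_k$ is the Chebyshev polynomial of the first kind, $\frac{1-xt}{1-2xt+t^2}=\sum_{k\ge0}T_k(x)t^k$; the right-hand side, a priori a rational function of $z$, is a polynomial in $z$. Both $p_n$ and $q_n$ have degree $2n$. For polynomials $f(x)=a_\mu x^\mu+\cdots+a_0$ and $g(x)=b_mx^m+\cdots+b_0$ of degrees $\mu$ and $m$, with complex zeros $\alpha_1,\ldots,\alpha_\mu$ and $\beta_1,\ldots,\beta_m$ (counted with multiplicity), the resultant is $$\mathrm{Res}(f,g)=a_{\mu}^m b_m^{\mu}\prod_{i=1}^{\mu}\prod_{j=1}^m(\alpha_i-\beta_j),$$ equivalently the Sylvester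 determinant; empty products are $1$. *)

theory Defs
  imports
    "HOL-Computational_Algebra.Computational_Algebra"
    "Subresultants.Resultant_Prelim"
begin

abbreviation Z :: "int poly"
  where "Z \<equiv> [:0, 1:]"

text \<open>The generating functions below are power series over the ring \<open>int poly\<close>, which has no
  division, so the reciprocal of a series with constant coefficient 1 is written as
  \<^term>\<open>fps_right_inverse D 1\<close>; it is the (unique) inverse of \<open>D\<close> by \<open>fps_right_inverse\<close>.\<close>

definition p_denom :: "int poly fps" where
  "p_denom = (1 - fps_const ((Z + 1)^2) * fps_X)^2 * (1 - fps_const ((Z - 1)^2) * fps_X)"

definition p_poly :: "nat \<Rightarrow> int poly" where
  "p_poly n = fps_nth (fps_right_inverse p_denom 1) n"

lemma p_poly_gen_fun: "p_denom * Abs_fps p_poly = 1"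
proof -
  have "p_denom * fps_right_inverse p_denom 1 = 1"
    by (rule fps_right_inverse) (simp add: p_denom_def fps_power_zeroth)
  moreover have "Abs_fps p_poly = fps_right_inverse p_denom 1"
    by (simp add: p_poly_def fps_eq_iff)
  ultimately show ?thesis by simp
qed

text \<open>Chebyshev polynomials of the first kind; here \<^term>\<open>Z\<close> plays the role of the variable \<open>x\<close>
  of the generating function \<open>(1 - x t) / (1 - 2 x t + t\<^sup>2)\<close>.\<close>

definition cheb_denom :: "int poly fps" where
  "cheb_denom = 1 - 2 * fps_const Z * fps_X + fps_X^2"

definition cheb_T :: "nat \<Rightarrow> int poly" where
  "cheb_T k = fps_nth ((1 - fps_const Z * fps_X) * fps_right_inverse cheb_denom 1) k"

lemma cheb_T_gen_fun: "cheb_denom * Abs_fps cheb_T = 1 - fps_const Z * fps_X"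
proof -
  have inv: "cheb_denom * fps_right_inverse cheb_denom 1 = 1"
    by (rule fps_right_inverse) (simp add: cheb_denom_def fps_power_zeroth)
  have "Abs_fps cheb_T = (1 - fps_const Z * fps_X) * fps_right_inverse cheb_denom 1"
    by (simp add: cheb_T_def fps_eq_iff)
  hence "cheb_denom * Abs_fps cheb_T
      = (1 - fps_const Z * fps_X) * (cheb_denom * fps_right_inverse cheb_denom 1)"
    by (simp only: mult.left_commute)
  thus ?thesis by (simp only: inv mult_1_right)
qed

lemma cheb_T_coeff_eq:
  "fps_nth (Abs_fps cheb_T - fps_const (2 * Z) * (fps_X * Abs_fps cheb_T)
     + fps_X ^ 2 * Abs_fps cheb_T) n = fps_nth (1 - fps_const Z * fps_X) n"
proof -
  have "cheb_denom * Abs_fps cheb_T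
     = Abs_fps cheb_T - fps_const (2 * Z) * (fps_X * Abs_fps cheb_T) + fps_X ^ 2 * Abs_fps cheb_T"
    by (simp add: cheb_denom_def algebra_simps numeral_fps_const flip: fps_const_mult)
  thus ?thesis by (simp only: cheb_T_gen_fun)
qed

lemma cheb_T_0: "cheb_T 0 = 1"
  using cheb_T_coeff_eq[of 0] by (simp add: fps_X_power_mult_nth)

lemma cheb_T_1: "cheb_T 1 = Z"
proof -
  have "cheb_T 1 - 2 * Z * cheb_T 0 = - Z"
    using cheb_T_coeff_eq[of 1]
    by (simp add: fps_X_power_mult_nth del: mult_pCons_left mult_pCons_right)
  moreover have "a = z" if "a - 2 * z * 1 = - z" for a z :: "int poly"
    using that by (simp add: algebra_simps)
  ultimately show ?thesis unfolding cheb_T_0 by blast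
qed

lemma cheb_T_rec: "cheb_T (n + 2) = 2 * Z * cheb_T (n + 1) - cheb_T n"
proof -
  have "cheb_T (n + 2) - 2 * Z * cheb_T (n + 1) + cheb_T n = 0"
    using cheb_T_coeff_eq[of "n + 2"]
    by (simp add: fps_X_power_mult_nth del: mult_pCons_left mult_pCons_right)
  moreover have "a = b - c" if "a - b + c = 0" for a b c :: "int poly"
    using that by (simp add: algebra_simps)
  ultimately show ?thesis by blast
qed

definition cheb_eval :: "nat \<Rightarrow> 'a::comm_ring_1 \<Rightarrow> 'a" where
  "cheb_eval k x = poly (map_poly of_int (cheb_T k)) x"

definition q_rat :: "nat \<Rightarrow> int poly fract" where
  "q_rat n =
     (let z = to_fract Z in
      (z + 1)^(2 * n) *
      (\<Sum>k = 0..n. ((z^2 - 1) / (z + 1)^2)^k * cheb_eval k ((z^2 + 1) / (z^2 - 1))))"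

text \<open>The rational function \<^term>\<open>q_rat n\<close> lies in \<open>int poly\<close>; see \<open>to_fract_q_poly\<close>.\<close>

definition q_poly :: "nat \<Rightarrow> int poly" where
  "q_poly n = (THE r. to_fract r = q_rat n)"

lemma cheb_eval_0: "cheb_eval 0 x = 1"
  by (simp add: cheb_eval_def cheb_T_0)

lemma cheb_eval_1: "cheb_eval 1 x = x"
  using cheb_T_1 by (simp add: cheb_eval_def map_poly_pCons)

lemma cheb_eval_rec:
  "cheb_eval (n + 2) x = 2 * x * cheb_eval (n + 1) x - cheb_eval n x"
proof -
  have "map_poly (of_int :: int \<Rightarrow> 'a) (cheb_T (n + 2))
      = map_poly of_int (2 * Z) * map_poly of_int (cheb_T (n + 1)) - map_poly of_int (cheb_T n)"
    by (simp only: cheb_T_rec of_int_poly_hom.hom_minus of_int_poly_hom.hom_mult)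
  moreover have "map_poly (of_int :: int \<Rightarrow> 'a) (2 * Z) = [:0, 2:]"
    by (simp add: numeral_poly map_poly_pCons)
  ultimately have "map_poly (of_int :: int \<Rightarrow> 'a) (cheb_T (n + 2))
      = [:0, 2:] * map_poly of_int (cheb_T (n + 1)) - map_poly of_int (cheb_T n)"
    by (simp only:)
  thus ?thesis by (simp add: cheb_eval_def mult_ac)
qed

lemma to_fract_power': "to_fract (x ^ n) = to_fract x ^ n"
  by (induction n) simp_all

lemma cheb_homogenized_polynomial:
  fixes z :: "int poly fract"
  defines "z \<equiv> to_fract Z"
  shows "\<exists>h. to_fract h = (z^2 - 1)^k * cheb_eval k ((z^2 + 1) / (z^2 - 1))"
proof (induction k rule: less_induct)
  case (less k)
  have z2: "z^2 - 1 = to_fract (Z^2 - 1)" "z^2 + 1 = to_fract (Z^2 + 1)"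
    by (simp_all only: z_def to_fract_power' to_fract_diff to_fract_add to_fract_1)
  have nz: "z^2 - 1 \<noteq> 0" unfolding z2 by (simp add: power2_eq_square one_pCons)
  let ?u = "(z^2 + 1) / (z^2 - 1)"
  consider "k = 0" | "k = 1" | j where "k = j + 2"
    by (metis One_nat_def Suc_1 Suc_eq_plus1 add_2_eq_Suc' not0_implies_Suc)
  thus ?case
  proof cases
    case 1
    thus ?thesis by (intro exI[of _ 1]) (simp add: cheb_eval_0)
  next
    case 2
    show ?thesis unfolding 2 cheb_eval_1 using nz z2(2) by (intro exI[of _ "Z^2 + 1"]) simp
  next
    case (3 j)
    obtain g h where g: "to_fract g = (z^2 - 1)^(j + 1) * cheb_eval (j + 1) ?u"
      and h: "to_fract h = (z^2 - 1)^j * cheb_eval j ?u"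
      using less.IH[of "j + 1"] less.IH[of j] 3 by auto
    have "(z^2 - 1)^k * cheb_eval k ?u
        = 2 * ((z^2 - 1) * ?u) * ((z^2 - 1)^(j + 1) * cheb_eval (j + 1) ?u)
          - (z^2 - 1)^2 * ((z^2 - 1)^j * cheb_eval j ?u)"
      unfolding 3 cheb_eval_rec by (simp only: power_add power2_eq_square power_one_right algebra_simps)
    also have "\<dots> = (to_fract (Z^2 + 1) + to_fract (Z^2 + 1)) * to_fract g
                     - (to_fract (Z^2 - 1))^2 * to_fract h"
      using nz unfolding g h z2[symmetric] by simp
    finally show ?thesis
      by (intro exI[of _ "(Z^2 + 1 + (Z^2 + 1)) * g - (Z^2 - 1)^2 * h"])
         (simp only: to_fract_add to_fract_diff to_fract_mult to_fract_power')
  qed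
qed

lemma to_fract_q_poly: "to_fract (q_poly n) = q_rat n"
proof -
  define z where "z = to_fract Z"
  have z1: "z + 1 = to_fract (Z + 1)" by (simp only: z_def to_fract_add to_fract_1)
  have nz: "z + 1 \<noteq> 0" unfolding z1 by (simp add: one_pCons)
  obtain h where h: "\<And>k. to_fract (h k) = (z^2 - 1)^k * cheb_eval k ((z^2 + 1) / (z^2 - 1))"
    using cheb_homogenized_polynomial unfolding z_def by metis
  have "q_rat n = (\<Sum>k = 0..n. (z + 1)^(2 * (n - k)) * to_fract (h k))"
    unfolding q_rat_def Let_def z_def[symmetric] sum_distrib_left
  proof (rule sum.cong)
    fix k assume "k \<in> {0..n}"
    hence "(z + 1)^(2 * n) = (z + 1)^(2 * (n - k)) * ((z + 1)^2)^k"
      by (simp flip: power_mult power_add add: algebra_simps)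
    thus "(z + 1)^(2 * n) * (((z^2 - 1) / (z + 1)^2)^k * cheb_eval k ((z^2 + 1) / (z^2 - 1)))
        = (z + 1)^(2 * (n - k)) * to_fract (h k)"
      using nz by (simp add: h power_divide)
  qed simp
  also have "\<dots> = to_fract (\<Sum>k = 0..n. (Z + 1)^(2 * (n - k)) * h k)"
    by (simp only: z1 to_fract_sum to_fract_mult to_fract_power')
  finally have "\<exists>r. to_fract r = q_rat n" by metis
  hence "\<exists>!r. to_fract r = q_rat n" by (metis to_fract_eq_iff)
  thus ?thesis unfolding q_poly_def by (rule theI')
qed

end

theory Submission
  imports Defs "Subresultants.Subresultant"
begin

text \<open>
  Put $a = (z+1)^2$ and $b = (z-1)^2$, so that $a - b = 4z$ and $b + 2z = z^2 + 1$.
  Clearing denominators in the generating function gives $p_{n+1} = b p_n + (n+2) a^{n+1}$, and the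
  Chebyshev sum telescopes to $q_{n+1} = (n+2) a^{n+1} - 2 z p_n = p_{n+1} - (z^2+1) p_n$.
  A resultant with $p_n$ depends, once the degree is fixed, only on the other argument modulo $p_n$.
  Hence $p_{n+1}$ and $q_{n+1}$ may both be replaced by $(n+2) a^{n+1}$, which leaves the value
  $p_n(-1) = 4^n$, and $\mathrm{Res}(p_{n+1}, q_{n+1})$ is the product of
  $\mathrm{Res}(p_{n+1}, p_n)$ and $p_{n+1}(i) p_{n+1}(-i)$.
\<close>

subsection \<open>Resultants and roots\<close>

text \<open>One Euclidean step: passing from \<open>g\<close> to its remainder \<open>h\<close>
  costs only a power of the leading coefficient of \<open>f\<close>, recording the drop in degree.
  It is read off from the subresultant relations, and their sign cancels against that of swapping
  the arguments.\<close>

lemma resultant_reduce: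
  fixes f g h k :: "'a :: idom poly"
  assumes eq: "g + k * f = h" and "degree h < degree f" "degree f \<le> degree g"
  shows "resultant f g = lead_coeff f ^ (degree g - degree h) * resultant f h"
proof -
  let ?s = "(-1) ^ (degree g * degree f) :: 'a"
  have "resultant g f = ?s * (lead_coeff f ^ (degree g - degree h) * resultant f h)"
  \<comment> \<open>The index-0 relation requires \<open>h\<close> of positive degree. For constant
    \<open>h\<close> the relation at index \<open>degree h\<close> applies instead, and one more
    factor \<open>c\<close> completes \<open>c ^ degree f\<close>, the resultant of \<open>f\<close>
    with a constant.\<close>
  proof (cases "degree h = 0")
    case True
    then obtain c where c: "h = [:c:]" by (meson degree_eq_zeroE)
    have "subresultant 0 g f = Polynomial.smult (?s * lead_coeff f ^ degree g * c ^ (degree f - 1)) h"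
      using BT_lemma_1_13[OF eq assms(3)] assms(2) c by simp
    moreover have "c ^ degree f = c ^ (degree f - 1) * c"
      using assms(2) True by (metis power_minus_mult)
    ultimately show ?thesis
      unfolding c by (simp add: subresultant_resultant mult_ac)
  next
    case False
    then show ?thesis
      using BT_lemma_1_12[OF eq assms(3), of 0] assms(2)
      by (simp add: subresultant_resultant mult_ac)
  qed
  then show ?thesis
    by (subst resultant_swap) (simp add: mult_ac flip: power_add)
qed

lemma prod_mset_neg_diff_swap:
  fixes A B :: "'a :: comm_ring_1 multiset"
  shows "(\<Prod>x\<in>#A. \<Prod>y\<in>#B. x - y) = (-1) ^ (size A * size B) * (\<Prod>y\<in>#B. \<Prod>x\<in>#A. y - x)"
proof (induction A)
  case (add a A)
  have "(\<Prod>y\<in>#B. a - y) = (-1) ^ size B * (\<Prod>y\<in>#B. y - a)"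
    by (induction B) (simp_all add: algebra_simps)
  then show ?case
    using add by (simp add: prod_mset.distrib power_add mult_ac)
qed simp

lemma poly_eq_prod_proots:
  "poly (f :: complex poly) x = lead_coeff f * (\<Prod>y\<in>#proots f. x - y)"
proof -
  have "poly f x = poly (Polynomial.smult (lead_coeff f) (\<Prod>y\<in>#proots f. [:-y, 1:])) x"
    by (simp only: complex_poly_decompose_multiset)
  also have "\<dots> = lead_coeff f * (\<Prod>y\<in>#proots f. x - y)"
    by (simp add: poly_prod_mset multiset.map_comp o_def)
  finally show ?thesis .
qed

lemma prod_mset_mult_const: "(\<Prod>x\<in>#A. c * f x) = c ^ size A * (\<Prod>x\<in>#A. f x)"
  for c :: "'a :: comm_monoid_mult"
  by (induction A) (simp_all add: mult_ac)

text \<open>Both sides expand to leading coefficients times the product of differences over all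
  pairs of zeros, and each pair contributes one sign. This mirrors
  \<open>resultant_swap\<close>.\<close>

lemma prod_proots_swap:
  fixes f g :: "complex poly"
  shows "lead_coeff f ^ degree g * (\<Prod>x\<in>#proots f. poly g x) =
    (-1) ^ (degree f * degree g) * (lead_coeff g ^ degree f * (\<Prod>y\<in>#proots g. poly f y))"
  unfolding poly_eq_prod_proots[of f] poly_eq_prod_proots[of g] prod_mset_mult_const
    size_proots_complex
  by (subst prod_mset_neg_diff_swap) (simp add: size_proots_complex mult_ac)

text \<open>Both sides change in the same way under swapping the arguments and under a step of the
  Euclidean algorithm.\<close>

lemma resultant_eq_prod_proots:
  fixes f g :: "complex poly"
  shows "resultant f g = lead_coeff f ^ degree g * (\<Prod>x\<in>#proots f. poly g x)"
proof (induction "degree f + degree g" arbitrary: f g rule: less_induct)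
  case less
  \<comment> \<open>Stated for any ordered pair with the same total degree, so that it serves
    \<open>f\<close>, \<open>g\<close> in either order.\<close>
  have step: "resultant u v = lead_coeff u ^ degree v * (\<Prod>x\<in>#proots u. poly v x)"
    if uv: "degree u > 0" "degree u \<le> degree v" "degree u + degree v = degree f + degree g"
    for u v :: "complex poly"
  proof -
    define h where "h = v mod u"
    have h: "degree h < degree u"
      unfolding h_def using uv by (metis degree_0 degree_mod_less' gr_implies_not0)
    have eq: "v + - (v div u) * u = h"
      unfolding h_def using div_mult_mod_eq[of v u] by (simp add: algebra_simps)
    have "resultant u v = lead_coeff u ^ (degree v - degree h) * resultant u h"
      by (rule resultant_reduce[OF eq h uv(2)])
    also have "resultant u h = lead_coeff u ^ degree h * (\<Prod>x\<in>#proots u. poly h x)"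
      using less[of u h] h uv by simp
    also have "(\<Prod>x\<in>#proots u. poly h x) = (\<Prod>x\<in>#proots u. poly v x)"
    proof (intro arg_cong[of _ _ prod_mset] image_mset_cong)
      fix x assume "x \<in># proots u"
      moreover have "u \<noteq> 0" using uv(1) by auto
      ultimately have "poly u x = 0" by simp
      then show "poly h x = poly v x" by (simp flip: eq)
    qed
    finally show ?thesis
      using h uv(2) by (simp flip: mult.assoc power_add)
  qed
  consider "degree f = 0" | "degree g = 0" | "degree f > 0" "degree f \<le> degree g"
    | "degree g > 0" "degree g \<le> degree f" by linarith
  then show ?case
  proof cases
    case 1
    then obtain c where "f = [:c:]" by (rule degree_eq_zeroE)
    then show ?thesis by simp
  next
    case 2
    then obtain c where c: "g = [:c:]" by (rule degree_eq_zeroE)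
    have "poly [:c:] = (\<lambda>_. c)" by auto
    then show ?thesis unfolding c by (simp add: size_proots_complex)
  next
    case 3
    then show ?thesis by (simp add: step)
  next
    case 4
    then show ?thesis
      by (simp add: resultant_swap[of f g] prod_proots_swap[of f g] step)
  qed
qed

text \<open>In the product formula over the complex numbers, both the degree in the exponent and the
  values at the zeros of \<open>f\<close> split; injectivity of \<open>of_int\<close> brings the
  identity back to the integers.\<close>

lemma resultant_mult_right:
  fixes f g h :: "int poly"
  assumes "g \<noteq> 0" "h \<noteq> 0"
  shows "resultant f (g * h) = resultant f g * resultant f h"
proof -
  have "of_int (resultant f (g * h)) = (of_int (resultant f g * resultant f h) :: complex)"
    using assms
    by (simp add: resultant_eq_prod_proots degree_mult_eq power_add prod_mset.distrib hom_distribs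
        flip: of_int_hom.resultant_hom)
  then show ?thesis by (simp only: of_int_eq_iff)
qed

text \<open>\<open>g\<close> and \<open>h\<close> agree at every zero of \<open>f\<close>, and equal
  degrees give the same power of the leading coefficient.\<close>

lemma resultant_cong_right:
  fixes f g h :: "int poly"
  assumes "degree g = degree h" "g = h + k * f"
  shows "resultant f g = resultant f h"
proof -
  let ?C = "of_int_poly :: int poly \<Rightarrow> complex poly"
  have "poly (?C g) x = poly (?C h) x" if "x \<in># proots (?C f)" for x
    using that unfolding assms(2) by (cases "f = 0") (auto simp: hom_distribs)
  then have "(\<Prod>x\<in>#proots (?C f). poly (?C g) x) = (\<Prod>x\<in>#proots (?C f). poly (?C h) x)"
    by (intro arg_cong[of _ _ prod_mset] image_mset_cong)
  then have "of_int (resultant f g) = (of_int (resultant f h) :: complex)"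
    using assms(1) by (simp add: resultant_eq_prod_proots flip: of_int_hom.resultant_hom)
  then show ?thesis by (simp only: of_int_eq_iff)
qed

lemma resultant_power_right:
  fixes f g :: "int poly"
  assumes "g \<noteq> 0"
  shows "resultant f (g ^ k) = resultant f g ^ k"
  using assms by (induction k) (simp_all add: resultant_mult_right)

lemma resultant_linear_right:
  fixes f :: "int poly"
  shows "resultant f [:-a, 1:] = (-1) ^ degree f * poly f a"
proof -
  have "of_int (resultant [:-a, 1:] f) = (of_int (poly f a) :: complex)"
  proof -
    have l: "of_int_poly [:-a, 1:] = [:- of_int a, 1 :: complex:]" by simp
    have "resultant [:- of_int a, 1:] (of_int_poly f) = poly (of_int_poly f) (of_int a :: complex)"
      unfolding resultant_eq_prod_proots proots_linear_factor by simp
    then show ?thesis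
      by (simp only: of_int_hom.resultant_hom[symmetric] l of_int_hom.poly_map_poly)
  qed
  then have "resultant [:-a, 1:] f = poly f a" by (simp only: of_int_eq_iff)
  then show ?thesis by (subst resultant_swap) simp
qed

text \<open>The zeros of the monic z^2 + 1 are i and -i, and its even degree makes the sign of the
  swap trivial.\<close>

lemma resultant_X2_plus_1_right:
  fixes f :: "int poly"
  shows "of_int (resultant f [:1, 0, 1:]) =
    poly (of_int_poly f) \<i> * poly (of_int_poly f) (- \<i>)"
proof -
  have factor: "[:1, 0, 1:] = [:\<i>, 1:] * [:-\<i>, 1:]" by simp
  have "[:\<i>, 1:] \<noteq> 0" "[:-\<i>, 1:] \<noteq> 0" by simp_all
  from proots_mult[OF this] have roots: "proots [:1, 0, 1:] = {#- \<i>, \<i>#}"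
    unfolding factor proots_linear_factor by simp
  have "of_int_poly [:1, 0, 1:] = [:1, 0, 1 :: complex:]" by simp
  then have "of_int (resultant [:1, 0, 1:] f) =
      resultant [:1, 0, 1 :: complex:] (of_int_poly f)"
    by (simp only: of_int_hom.resultant_hom[symmetric])
  also have "\<dots> = poly (of_int_poly f) \<i> * poly (of_int_poly f) (- \<i>)"
    unfolding resultant_eq_prod_proots roots by (simp add: mult_ac)
  finally show ?thesis
    by (subst resultant_swap) simp
qed

subsection \<open>Recurrences\<close>

lemma p_poly_0 [simp]: "p_poly 0 = 1"
  by (simp add: p_poly_def)

lemma p_poly_Suc: "p_poly (Suc n) = (Z - 1)\<^sup>2 * p_poly n + of_nat (n + 2) * ((Z + 1)\<^sup>2) ^ Suc n"
proof -
  define a b where "a = (Z + 1)\<^sup>2" and "b = (Z - 1)\<^sup>2"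
  \<comment> \<open>The linear factors of the denominator are peeled off one by one:
    \<open>E\<close> is 1/(1 - a t)^2 and \<open>F\<close> is the geometric series 1/(1 - a
    t).\<close>
  define E where "E = (1 - fps_const b * fps_X) * Abs_fps p_poly"
  define F where "F = (1 - fps_const a * fps_X) * E"
  have one: "(1 - fps_const a * fps_X) * F = 1"
    using p_poly_gen_fun by (simp add: E_def F_def p_denom_def a_def b_def power2_eq_square mult_ac)
  have linear_nth: "fps_nth ((1 - fps_const c * fps_X) * G) (Suc k) = fps_nth G (Suc k) - c * fps_nth G k"
    for c :: "int poly" and G k
    by (simp add: left_diff_distrib mult.assoc)
  have linear_nth_0: "fps_nth ((1 - fps_const c * fps_X) * G) 0 = fps_nth G 0" for c :: "int poly" and G
    by (simp add: left_diff_distrib mult.assoc)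
  have F: "fps_nth F k = a ^ k" for k
  proof (induction k)
    case 0
    show ?case using linear_nth_0[of a F] by (simp add: one)
  next
    case (Suc k)
    then show ?case using linear_nth[of a F k] by (simp add: one)
  qed
  have E: "fps_nth E k = of_nat (k + 1) * a ^ k" for k
  proof (induction k)
    case 0
    show ?case using linear_nth_0[of a E] F[of 0] by (simp flip: F_def)
  next
    case (Suc k)
    have "fps_nth E (Suc k) = a * fps_nth E k + a ^ Suc k"
      using linear_nth[of a E k] F[of "Suc k"] by (simp flip: F_def)
    then show ?case by (simp only: Suc) (simp add: algebra_simps)
  qed
  have "p_poly (Suc n) = b * p_poly n + fps_nth E (Suc n)"
    using linear_nth[of b "Abs_fps p_poly" n] by (simp flip: E_def)
  then show ?thesis unfolding E by (simp add: a_def b_def)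
qed

text \<open>The partial fraction expansion of the generating function with denominators cleared. It
  serves to eliminate the power of \<open>b\<close> in the proof of
  \<open>q_poly_Suc_eq\<close>.\<close>

lemma p_poly_closed_form:
  defines "a \<equiv> (Z + 1)\<^sup>2" and "b \<equiv> (Z - 1)\<^sup>2"
  shows "(a - b)\<^sup>2 * p_poly n = b ^ (n + 2) - a ^ (n + 2) + of_nat (n + 2) * (a - b) * a ^ (n + 1)"
proof (induction n)
  case 0
  show ?case by (simp add: power2_eq_square algebra_simps)
next
  case (Suc n)
  have "(a - b)\<^sup>2 * p_poly (Suc n) = b * ((a - b)\<^sup>2 * p_poly n) + of_nat (n + 2) * (a - b)\<^sup>2 * a ^ Suc n"
    unfolding p_poly_Suc a_def[symmetric] b_def[symmetric] by (simp only: distrib_left mult_ac)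
  then show ?case
    unfolding Suc by (simp add: power2_eq_square algebra_simps)
qed

text \<open>Since $(z^2+1)/(z^2-1)$ is the average of $(z+1)/(z-1)$ and its inverse, $T_k$ takes at it
  the average of the $k$-th powers.\<close>

lemma cheb_eval_homogenized:
  fixes z :: "'a :: field"
  assumes "z\<^sup>2 \<noteq> 1"
  shows "2 * (z\<^sup>2 - 1) ^ k * cheb_eval k ((z\<^sup>2 + 1) / (z\<^sup>2 - 1)) = ((z + 1)\<^sup>2) ^ k + ((z - 1)\<^sup>2) ^ k"
proof -
  define w u a b where "w = z\<^sup>2 - 1" and "u = (z\<^sup>2 + 1) / w"
    and "a = (z + 1)\<^sup>2" and "b = (z - 1)\<^sup>2"
  have wu: "2 * (w * u) = a + b"
  proof -
    have "w * u = z\<^sup>2 + 1" using assms by (simp add: w_def u_def)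
    then show ?thesis by (simp add: a_def b_def power2_sum power2_diff)
  qed
  have w2: "w\<^sup>2 = a * b"
  proof -
    have "w = (z + 1) * (z - 1)" by (simp add: w_def power2_eq_square algebra_simps)
    then show ?thesis by (simp only: a_def b_def power_mult_distrib)
  qed
  \<comment> \<open>By \<open>wu\<close> and \<open>w2\<close>, scaling the Chebyshev recurrence by
    powers of \<open>w\<close> turns it into the recurrence of the power sums of \<open>a\<close>
    and \<open>b\<close>.\<close>
  have "2 * w ^ k * cheb_eval k u = a ^ k + b ^ k"
  proof (induction k rule: induct_nat_012)
    case 0
    show ?case by (simp add: cheb_eval_0)
  next
    case 1
    show ?case using cheb_eval_1[of u] wu by (simp add: mult.assoc)
  next
    case (ge2 k)
    have "2 * w ^ (k + 2) * cheb_eval (k + 2) u =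
        2 * (w * u) * (2 * w ^ Suc k * cheb_eval (Suc k) u) - w\<^sup>2 * (2 * w ^ k * cheb_eval k u)"
      unfolding cheb_eval_rec by (simp add: power2_eq_square algebra_simps)
    also have "\<dots> = (a + b) * (a ^ Suc k + b ^ Suc k) - a * b * (a ^ k + b ^ k)"
      by (simp only: wu w2 ge2)
    also have "\<dots> = a ^ Suc (Suc k) + b ^ Suc (Suc k)"
      by (simp add: algebra_simps)
    finally show ?case by simp
  qed
  then show ?thesis by (simp only: w_def u_def a_def b_def)
qed

section \<open>The Chebyshev sums in terms of the polynomials p_n\<close>

lemma q_poly_0: "q_poly 0 = 1"
proof -
  have "to_fract (q_poly 0) = to_fract 1"
    unfolding to_fract_q_poly by (simp add: q_rat_def cheb_eval_0)
  then show ?thesis by simp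
qed

lemma Z_plus_1: "Z + 1 = [:1, 1:]"
  by (simp add: one_pCons del: pCons_one)

lemma Z_minus_1: "Z - 1 = [:-1, 1:]"
  by (simp add: one_pCons del: pCons_one)

lemma q_rat_Suc:
  fixes n and z defines "z \<equiv> to_fract Z"
  shows "q_rat (Suc n) = (z + 1)\<^sup>2 * q_rat n + (z\<^sup>2 - 1) ^ Suc n * cheb_eval (Suc n) ((z\<^sup>2 + 1) / (z\<^sup>2 - 1))"
proof -
  have "z + 1 = to_fract (Z + 1)" by (simp only: z_def to_fract_add to_fract_1)
  then have nz: "z + 1 \<noteq> 0" unfolding Z_plus_1 by simp
  define w where "w = z\<^sup>2 - 1"
  have "(z + 1) ^ (2 * Suc n) * (w / (z + 1)\<^sup>2) ^ Suc n = w ^ Suc n"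
    using nz by (simp only: power_mult power_mult_distrib[symmetric]) simp
  moreover have "(z + 1) ^ (2 * Suc n) = (z + 1)\<^sup>2 * (z + 1) ^ (2 * n)"
    by (simp add: power2_eq_square)
  ultimately show ?thesis
    unfolding q_rat_def Let_def z_def[symmetric] w_def[symmetric]
    by (simp only: sum.atLeast0_atMost_Suc distrib_left mult.assoc[symmetric])
qed

text \<open>The new Chebyshev term is a half-sum of two powers, so doubling keeps the identity
  inside \<open>int poly\<close>. It is derived in the fraction field and pulled back along the
  injective \<open>to_fract\<close>.\<close>

lemma q_poly_Suc:
  "2 * q_poly (Suc n) = 2 * (Z + 1)\<^sup>2 * q_poly n + ((Z + 1)\<^sup>2) ^ Suc n + ((Z - 1)\<^sup>2) ^ Suc n"
proof -
  define z where "z = to_fract Z"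
  have z: "to_fract (Z + 1) = z + 1" "to_fract (Z - 1) = z - 1"
    by (simp_all only: z_def to_fract_add to_fract_diff to_fract_1)
  have "z + 1 \<noteq> 0" "z - 1 \<noteq> 0"
    unfolding z[symmetric] Z_plus_1 Z_minus_1 by simp_all
  moreover have "z\<^sup>2 - 1 = (z + 1) * (z - 1)" by (simp add: power2_eq_square algebra_simps)
  ultimately have nz: "z\<^sup>2 \<noteq> 1" by auto
  have "2 * q_rat (Suc n) = 2 * (z + 1)\<^sup>2 * q_rat n +
      2 * (z\<^sup>2 - 1) ^ Suc n * cheb_eval (Suc n) ((z\<^sup>2 + 1) / (z\<^sup>2 - 1))"
    unfolding q_rat_Suc z_def[symmetric] by (simp only: distrib_left mult.assoc)
  then have "2 * q_rat (Suc n) = 2 * (z + 1)\<^sup>2 * q_rat n + ((z + 1)\<^sup>2) ^ Suc n + ((z - 1)\<^sup>2) ^ Suc n"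
    by (simp only: cheb_eval_homogenized[OF nz] add.assoc)
  moreover have "to_fract 2 = (2 :: int poly fract)"
    by (metis one_add_one to_fract_1 to_fract_add)
  ultimately have "to_fract (2 * q_poly (Suc n)) =
      to_fract (2 * (Z + 1)\<^sup>2 * q_poly n + ((Z + 1)\<^sup>2) ^ Suc n + ((Z - 1)\<^sup>2) ^ Suc n)"
    by (simp only: to_fract_mult to_fract_add to_fract_power' to_fract_q_poly to_fract_diff to_fract_1 z_def[symmetric])
  then show ?thesis by (simp only: to_fract_eq_iff)
qed

lemma Z_plus_1_sq_minus_Z_minus_1_sq: "(Z + 1)\<^sup>2 - (Z - 1)\<^sup>2 = 4 * Z"
  unfolding Z_plus_1 Z_minus_1
  by (simp add: power2_eq_square numeral_poly one_pCons del: pCons_one)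

lemma q_poly_Suc_eq: "q_poly (Suc n) = of_nat (n + 2) * ((Z + 1)\<^sup>2) ^ Suc n - 2 * Z * p_poly n"
proof -
  define a b where "a = (Z + 1)\<^sup>2" and "b = (Z - 1)\<^sup>2"
  \<comment> \<open>Doubled, and with \<open>a - b\<close> in place of 4z, the induction is pure
    algebra in \<open>a\<close>, \<open>b\<close> and \<open>p_poly n\<close>.\<close>
  have "2 * q_poly (Suc n) = 2 * of_nat (n + 2) * a ^ Suc n - (a - b) * p_poly n"
  proof (induction n)
    case 0
    show ?case using q_poly_Suc[of 0]
      by (simp add: q_poly_0 a_def b_def algebra_simps)
  next
    case (Suc n)
    have "2 * q_poly (Suc (Suc n)) = a * (2 * q_poly (Suc n)) + a ^ (n + 2) + b ^ (n + 2)"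
      using q_poly_Suc[of "Suc n"] by (simp add: a_def b_def mult_ac)
    \<comment> \<open>The last bracket vanishes by \<open>p_poly_closed_form\<close>, and the factor
      after the first \<open>a - b\<close> is \<open>p_poly (Suc n)\<close>.\<close>
    also have "\<dots> = 2 * of_nat (n + 3) * a ^ (n + 2) - (a - b) * (b * p_poly n + of_nat (n + 2) * a ^ Suc n)
        - ((a - b)\<^sup>2 * p_poly n - (b ^ (n + 2) - a ^ (n + 2) + of_nat (n + 2) * (a - b) * a ^ (n + 1)))"
      unfolding Suc by (simp add: algebra_simps power2_eq_square)
    finally show ?case
      using p_poly_closed_form[of n] by (simp add: p_poly_Suc a_def b_def)
  qed
  moreover have "2 * (x - 2 * Z * y) = 2 * x - 4 * Z * y" for x y
    by (simp add: right_diff_distrib flip: mult.assoc)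
  ultimately have "2 * q_poly (Suc n) = 2 * (of_nat (n + 2) * a ^ Suc n - 2 * Z * p_poly n)"
    unfolding a_def b_def Z_plus_1_sq_minus_Z_minus_1_sq by (simp only: mult.assoc)
  moreover have "x = y" if "2 * x = 2 * y" for x y :: "int poly"
    using that by simp
  ultimately show ?thesis unfolding a_def by blast
qed

lemma q_poly_Suc_eq_p_poly:
  "q_poly (Suc n) = p_poly (Suc n) + - [:1, 0, 1:] * p_poly n"
proof -
  have "(Z - 1)\<^sup>2 + 2 * Z = [:1, 0, 1:]"
    unfolding Z_minus_1 by (simp add: power2_eq_square numeral_poly)
  then have c: "[:1, 0, 1:] = (Z - 1)\<^sup>2 + 2 * Z" ..
  have "e - d * x = b * x + e + - (b + d) * x" for b d e x :: "int poly"
    by (simp add: algebra_simps)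
  then show ?thesis unfolding q_poly_Suc_eq p_poly_Suc c .
qed

subsection \<open>Degrees and values\<close>

lemma degree_of_nat_mult_power:
  "degree (of_nat (n + 2) * ((Z + 1)\<^sup>2) ^ k) = 2 * k"
  unfolding Z_plus_1 of_nat_poly by (simp add: degree_power_eq)

text \<open>Both summands of the recurrence have positive top coefficients, so nothing cancels. The
  degree bound belongs to the induction because it isolates the top coefficient of the product with
  (z-1)^2.\<close>

lemma degree_p_poly_le_lead_coeff_pos: "degree (p_poly n) \<le> 2 * n \<and> coeff (p_poly n) (2 * n) > 0"
proof (induction n)
  case (Suc n)
  have b: "(Z - 1)\<^sup>2 = [:1, -2, 1:]" unfolding Z_minus_1 by (simp add: power2_eq_square)
  have ab: "degree ((Z - 1)\<^sup>2) = 2" "degree ((Z + 1)\<^sup>2) = 2"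
    unfolding Z_minus_1 Z_plus_1 by (simp_all add: degree_power_eq)
  have "lead_coeff (((Z + 1)\<^sup>2) ^ Suc n) = 1"
    unfolding lead_coeff_power Z_plus_1 by simp
  moreover have deg: "degree (((Z + 1)\<^sup>2) ^ Suc n) = 2 * Suc n"
    by (subst degree_power_eq) (use ab in auto)
  ultimately have a: "coeff (((Z + 1)\<^sup>2) ^ Suc n) (2 * Suc n) = 1"
    by simp
  have "degree ((Z - 1)\<^sup>2 * p_poly n) \<le> 2 * Suc n"
    using degree_mult_le[of "(Z - 1)\<^sup>2" "p_poly n"] ab Suc by auto
  moreover have "degree (of_nat (n + 2) * ((Z + 1)\<^sup>2) ^ Suc n) \<le> 2 * Suc n"
    by (simp only: degree_of_nat_mult_power)
  moreover have "coeff ((Z - 1)\<^sup>2 * p_poly n) (2 * Suc n) = coeff (p_poly n) (2 * n)"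
    using Suc unfolding b by (simp add: coeff_eq_0)
  ultimately show ?case
    using Suc a unfolding p_poly_Suc
    by (auto simp: of_nat_poly intro: degree_add_le)
qed simp

lemma degree_p_poly [simp]: "degree (p_poly n) = 2 * n"
  using degree_p_poly_le_lead_coeff_pos[of n] le_degree[of "p_poly n" "2 * n"] by linarith

lemma p_poly_nonzero [simp]: "p_poly n \<noteq> 0"
  using degree_p_poly_le_lead_coeff_pos[of n] by auto

lemma degree_q_poly: "degree (q_poly (Suc n)) = 2 * Suc n"
proof -
  have "degree (2 * Z * p_poly n) = Suc (2 * n)"
    by (subst degree_mult_eq) (simp_all add: numeral_poly)
  then show ?thesis
    unfolding q_poly_Suc_eq diff_conv_add_uminus
    by (subst degree_add_eq_left) (simp_all only: degree_minus degree_of_nat_mult_power, simp)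
qed

text \<open>At z = -1 the term with (z+1)^2 drops out of the recurrence and (z-1)^2 becomes
  4.\<close>

lemma poly_p_poly_neg1: "poly (p_poly n) (-1) = 4 ^ n"
  by (induction n) (simp_all add: p_poly_Suc)

subsection \<open>The resultants\<close>

text \<open>By multiplicativity: the constant n+2 enters to the power
  \<open>degree (p_poly n)\<close>, and each of the 2(n+1) factors z+1 contributes p_n(-1), without
  sign since that degree is even.\<close>

lemma resultant_p_poly_power:
  "resultant (p_poly n) (of_nat (n + 2) * ((Z + 1)\<^sup>2) ^ Suc n) = (int n + 2) ^ (2 * n) * 2 ^ (4 * n * (n + 1))"
proof -
  have lin: "Z + 1 = [:- (- 1), 1:]" unfolding Z_plus_1 by simp
  have 1: "resultant (p_poly n) (Z + 1) = 4 ^ n"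
    unfolding lin resultant_linear_right by (simp add: poly_p_poly_neg1)
  have nz: "Z + 1 \<noteq> 0" unfolding Z_plus_1 by simp
  have "resultant (p_poly n) (of_nat (n + 2)) = (int n + 2) ^ (2 * n)"
    unfolding of_nat_poly by (simp add: add.commute)
  moreover have "resultant (p_poly n) (((Z + 1)\<^sup>2) ^ Suc n) = ((4 ^ n)\<^sup>2) ^ Suc n"
    unfolding resultant_power_right[OF power_not_zero[OF nz]] resultant_power_right[OF nz] 1 ..
  moreover have "of_nat (n + 2) \<noteq> (0 :: int poly)" by (simp only: of_nat_eq_0_iff)
  moreover have "((Z + 1)\<^sup>2) ^ Suc n \<noteq> 0" by (intro power_not_zero nz)
  ultimately have "resultant (p_poly n) (of_nat (n + 2) * ((Z + 1)\<^sup>2) ^ Suc n) =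
      (int n + 2) ^ (2 * n) * ((4 ^ n)\<^sup>2) ^ Suc n"
    by (metis resultant_mult_right)
  also have "((4 ^ n)\<^sup>2) ^ Suc n = (2::int) ^ (4 * n * (n + 1))"
  proof -
    have "(4::int) = 2\<^sup>2" by simp
    then show ?thesis by (simp only: power_mult[symmetric]) (simp add: algebra_simps)
  qed
  finally show ?thesis .
qed

lemma resultant_p_poly_Suc:
  "resultant (p_poly n) (p_poly (Suc n)) = (int n + 2) ^ (2 * n) * 2 ^ (4 * n * (n + 1))"
proof -
  have "resultant (p_poly n) (p_poly (Suc n)) =
      resultant (p_poly n) (of_nat (n + 2) * ((Z + 1)\<^sup>2) ^ Suc n)"
  proof (rule resultant_cong_right)
    show "p_poly (Suc n) = of_nat (n + 2) * ((Z + 1)\<^sup>2) ^ Suc n + (Z - 1)\<^sup>2 * p_poly n"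
      unfolding p_poly_Suc by (rule add.commute)
  qed (simp only: degree_p_poly degree_of_nat_mult_power)
  then show ?thesis by (simp only: resultant_p_poly_power)
qed

lemma resultant_p_poly_q_poly_Suc:
  "resultant (p_poly n) (q_poly (Suc n)) = (int n + 2) ^ (2 * n) * 2 ^ (4 * n * (n + 1))"
proof -
  have "resultant (p_poly n) (q_poly (Suc n)) =
      resultant (p_poly n) (of_nat (n + 2) * ((Z + 1)\<^sup>2) ^ Suc n)"
  proof (rule resultant_cong_right)
    show "q_poly (Suc n) = of_nat (n + 2) * ((Z + 1)\<^sup>2) ^ Suc n + (- (2 * Z)) * p_poly n"
      unfolding q_poly_Suc_eq by (simp only: diff_conv_add_uminus minus_mult_left)
  qed (simp only: degree_q_poly degree_of_nat_mult_power)
  then show ?thesis by (simp only: resultant_p_poly_power)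
qed

text \<open>Writing p_n(w) = (2w)^n c_n, the recurrence becomes c_(n+1) = (n+2) - c_n. This
  alternation is the source of the parity distinction in the theorem.\<close>

lemma poly_p_poly_sqrt_neg1:
  fixes w :: complex
  assumes "w\<^sup>2 = - 1"
  shows "poly (of_int_poly (p_poly n)) w = (2 * w) ^ n * of_nat (n div 2 + 1)"
proof (induction n)
  case (Suc n)
  have w: "(w - 1)\<^sup>2 = - (2 * w)" "(w + 1)\<^sup>2 = 2 * w"
    using assms by (simp_all add: power2_sum power2_diff)
  have "poly (of_int_poly (p_poly (Suc n))) w =
      (w - 1)\<^sup>2 * poly (of_int_poly (p_poly n)) w + of_nat (n + 2) * ((w + 1)\<^sup>2) ^ Suc n"
    unfolding p_poly_Suc Z_plus_1 Z_minus_1 by (simp add: hom_distribs add.commute)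
  also have "\<dots> = (2 * w) ^ Suc n * (of_nat (n + 2) - of_nat (n div 2 + 1))"
    unfolding Suc w by (simp add: algebra_simps)
  also have "n + 2 = (n div 2 + 1) + (Suc n div 2 + 1)"
    by presburger
  finally show ?case by simp
qed simp

lemma resultant_p_poly_X2_plus_1:
  "resultant (p_poly n) [:1, 0, 1:] = 4 ^ n * (int (n div 2) + 1)\<^sup>2"
proof -
  have "of_int (resultant (p_poly n) [:1, 0, 1:]) =
      ((2 * \<i>) ^ n * (2 * (- \<i>)) ^ n) * (of_nat (n div 2 + 1))\<^sup>2"
    unfolding resultant_X2_plus_1_right
    by (simp add: poly_p_poly_sqrt_neg1 power2_eq_square)
  also have "(2 * \<i>) ^ n * (2 * (- \<i>)) ^ n = 4 ^ n"
    unfolding power_mult_distrib[symmetric] by simp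
  also have "4 ^ n * (of_nat (n div 2 + 1))\<^sup>2 = (of_int (4 ^ n * (int (n div 2) + 1)\<^sup>2) :: complex)"
    by (simp add: add.commute)
  finally show ?thesis by (simp only: of_int_eq_iff)
qed

lemma resultant_p_poly_q_poly:
  "resultant (p_poly (Suc n)) (q_poly (Suc n)) =
    4 ^ Suc n * (int (Suc n div 2) + 1)\<^sup>2 * ((int n + 2) ^ (2 * n) * 2 ^ (4 * n * (n + 1)))"
proof -
  \<comment> \<open>This matches the degree of \<open>q_poly (Suc n)\<close>, so the reduction
    modulo \<open>p_poly (Suc n)\<close> introduces no power of a leading coefficient.\<close>
  have deg: "degree (- [:1, 0, 1:] * p_poly n) = 2 * Suc n"
    by (subst degree_mult_eq) simp_all
  have "resultant (p_poly (Suc n)) (q_poly (Suc n)) = resultant (p_poly (Suc n)) (- [:1, 0, 1:] * p_poly n)"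
  proof (rule resultant_cong_right)
    show "q_poly (Suc n) = - [:1, 0, 1:] * p_poly n + 1 * p_poly (Suc n)"
      unfolding q_poly_Suc_eq_p_poly mult_1 by (rule add.commute)
  qed (simp only: deg degree_q_poly)
  also have "\<dots> = resultant (p_poly (Suc n)) (- [:1, 0, 1:]) * resultant (p_poly (Suc n)) (p_poly n)"
    by (intro resultant_mult_right) simp_all
  \<comment> \<open>The sign is raised to the even degree of \<open>p_poly (Suc n)\<close>; the same
    parity removes the sign in the swap that follows.\<close>
  also have "resultant (p_poly (Suc n)) (- [:1, 0, 1:]) = resultant (p_poly (Suc n)) [:1, 0, 1:]"
  proof -
    have "- [:1, 0, 1:] = Polynomial.smult (- 1) [:1, 0, 1 :: int:]"
      by (simp only: smult_minus_left smult_1_left)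
    then show ?thesis by (simp only: resultant_smult_right) simp
  qed
  also have "resultant (p_poly (Suc n)) (p_poly n) = resultant (p_poly n) (p_poly (Suc n))"
    by (subst resultant_swap) simp
  finally show ?thesis
    by (simp only: resultant_p_poly_X2_plus_1 resultant_p_poly_Suc)
qed

theorem proposition5p3:
  fixes n :: nat
  shows "resultant (p_poly n) (q_poly (n + 1)) = resultant (p_poly n) (p_poly (n + 1))
    \<and> resultant (p_poly n) (p_poly (n + 1)) = (int n + 2) ^ (2 * n) * 2 ^ (4 * n * (n + 1))
    \<and> (of_int (resultant (p_poly n) (q_poly n)) :: rat) =
         (of_nat n + 1) powi (2 * int n - 2) * 2 powi (2 * (int n - 1) * (2 * int n + 1)) *
         (if even n then (of_nat n + 2) ^ 2 else (of_nat n + 1) ^ 2)"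
proof (intro conjI)
  show "resultant (p_poly n) (q_poly (n + 1)) = resultant (p_poly n) (p_poly (n + 1))"
    by (simp add: resultant_p_poly_Suc resultant_p_poly_q_poly_Suc)
  show "resultant (p_poly n) (p_poly (n + 1)) = (int n + 2) ^ (2 * n) * 2 ^ (4 * n * (n + 1))"
    using resultant_p_poly_Suc[of n] by simp
  show "(of_int (resultant (p_poly n) (q_poly n)) :: rat) =
         (of_nat n + 1) powi (2 * int n - 2) * 2 powi (2 * (int n - 1) * (2 * int n + 1)) *
         (if even n then (of_nat n + 2) ^ 2 else (of_nat n + 1) ^ 2)"
  proof (cases n)
    \<comment> \<open>Here both integer exponents equal -2: the factor 2^(-2) cancels (0+2)^2, and
      the resultant with p_0 = 1 is 1.\<close>
    case 0
    then show ?thesis by (simp add: power_int_minus)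
  next
    case (Suc m)
    let ?h = "of_nat (Suc m div 2) + 1 :: rat"
    have e1: "2 * int n - 2 = int (2 * m)" and
      e2: "2 * (int n - 1) * (2 * int n + 1) = int (4 * m * (m + 1) + 2 * m)"
      unfolding Suc by (simp_all add: algebra_simps)
    \<comment> \<open>Twice \<open>?h\<close> is n+2 for even n and n+1 for odd n, so one expression
      covers both cases.\<close>
    have h: "(if even n then (of_nat n + 2) ^ 2 else (of_nat n + 1) ^ 2) = 4 * ?h\<^sup>2"
    proof (cases "even n")
      case True
      then have "Suc m = 2 * (Suc m div 2)" using Suc by simp
      then have "of_nat n + 2 = 2 * ?h" unfolding Suc
        by (metis (no_types, lifting) distrib_left mult.right_neutral of_nat_mult of_nat_numeral)
      then show ?thesis using True by (simp only: if_True power_mult_distrib) simp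
    next
      case False
      then have "Suc m + 1 = 2 * (Suc m div 2 + 1)" using Suc by presburger
      then have "of_nat n + 1 = 2 * ?h" unfolding Suc
        by (metis of_nat_1 of_nat_add of_nat_mult of_nat_numeral)
      then show ?thesis using False by (simp only: if_False power_mult_distrib) simp
    qed
    have "(of_int (resultant (p_poly n) (q_poly n)) :: rat) =
        4 ^ Suc m * ?h\<^sup>2 * ((of_nat m + 2) ^ (2 * m) * 2 ^ (4 * m * (m + 1)))"
      unfolding Suc resultant_p_poly_q_poly by simp
    also have "\<dots> = (of_nat n + 1) ^ (2 * m) * 2 ^ (4 * m * (m + 1) + 2 * m) * (4 * ?h\<^sup>2)"
    proof -
      have "(4::rat) ^ Suc m = 4 * 2 ^ (2 * m)" by (simp add: power_mult)
      moreover have "(of_nat n + 1 :: rat) = of_nat m + 2" by (simp add: Suc)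
      ultimately show ?thesis by (simp only: power_add mult_ac)
    qed
    finally show ?thesis unfolding e1 e2 h power_int_of_nat .
  qed
qed

end
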